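(* Let $X$ be a separable zero-dimensional metrizable space. The following are equivalent: (1) $X$ has the Hurewicz property; (2) every large open cover of $X$ contains a groupable cover of $X$ (that is, for every large open cover $\mathcal{U}$ of $X$ there is a subfamily $\mathcal{W}\subseteq\mathcal{U}$ which is a groupable cover of $X$); (3) every countable large open cover of $X$ is groupable.
   Context: Zero-dimensional means having a base of clopen sets. Open covers of $X$ are sets (without repetition) of open subsets of $X$ whose union is $X$. $X$ has the Hurewicz property if for each sequence $(\mathcal{U}_n)_{n\in\mathbb{N}}$ of open covers of $X$ there exist finite subsets $\mathcal{F}_n\subseteq\mathcal{U}_n$, $n\in\mathbb{N}$, such that $X\subseteq\bigcup_n\bigcap_{m>n}\left(\bigcup\mathcal{F}_m\right)$. A family $\mathcal{U}$ is a large cover of $X$ if each $x\in X$ is contained in infinitely many members of $\mathcal{U}$. A large cover $\mathcal{U}$ of $X$ is groupable if there exists a partition $\mathcal{P}$ of $\mathcal{U}$ into finite sets such that for each $x\in X$, $x\in\bigcup\mathcal{F}$ for all but finitely many $\mathcal{F}\in\mathcal{P}$. *)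

theory Defs
  imports "HOL-Analysis.Analysis"
begin

definition zero_dimensional_space :: "'a topology \<Rightarrow> bool" where
  "zero_dimensional_space X \<longleftrightarrow>
     (\<exists>\<B>. (\<forall>V\<in>\<B>. openin X V \<and> closedin X V) \<and>
          (\<forall>U x. openin X U \<and> x \<in> U \<longrightarrow> (\<exists>V\<in>\<B>. x \<in> V \<and> V \<subseteq> U)))"

definition open_cover :: "'a topology \<Rightarrow> 'a set set \<Rightarrow> bool" where
  "open_cover X \<U> \<longleftrightarrow> (\<forall>U\<in>\<U>. openin X U) \<and> \<Union>\<U> = topspace X"

definition hurewicz_space :: "'a topology \<Rightarrow> bool" where
  "hurewicz_space X \<longleftrightarrow>
     (\<forall>\<U> :: nat \<Rightarrow> 'a set set. (\<forall>n. open_cover X (\<U> n)) \<longrightarrow>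
        (\<exists>\<F>. (\<forall>n. finite (\<F> n) \<and> \<F> n \<subseteq> \<U> n) \<and>
             topspace X \<subseteq> (\<Union>n. \<Inter>m\<in>{n<..}. \<Union>(\<F> m))))"

definition large_cover :: "'a topology \<Rightarrow> 'a set set \<Rightarrow> bool" where
  "large_cover X \<U> \<longleftrightarrow> (\<forall>x\<in>topspace X. infinite {U\<in>\<U>. x \<in> U})"

definition groupable_cover :: "'a topology \<Rightarrow> 'a set set \<Rightarrow> bool" where
  "groupable_cover X \<U> \<longleftrightarrow>
     large_cover X \<U> \<and>
     (\<exists>\<P>. partition_on \<U> \<P> \<and> (\<forall>\<F>\<in>\<P>. finite \<F>) \<and>
          (\<forall>x\<in>topspace X. finite {\<F>\<in>\<P>. x \<notin> \<Union>\<F>}))"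

end

theory Submission
  imports Defs
begin

text \<open>
  If \<open>X\<close> is Hurewicz and \<open>U\<^sub>0, U\<^sub>1, \<dots>\<close> enumerates a large cover, the Hurewicz property for the covers
  \<open>{U\<^sub>n \<union> \<dots> \<union> U\<^sub>m | m \<ge> n}\<close> gives \<open>g\<close> such that every point lies in \<open>U\<^sub>n \<union> \<dots> \<union> U\<^bsub>g n\<^esub>\<close> for almost
  all \<open>n\<close>; iterating \<open>g\<close> cuts the enumeration into the required blocks. As \<open>X\<close> is Lindelof, every
  large cover has a countable large subcover.

  Conversely, each cover of a given sequence may be refined by a countable clopen partition, so a point
  \<open>x\<close> determines a sequence of indices, and it suffices to bound all these sequences by a single one
  modulo finite sets. They are dominated by strictly increasing \<open>f x\<close>, and a groupable subcover of the
  cover by the sets \<open>{x. m \<in> range (f x)}\<close> is a sequence of disjoint finite sets of naturals, almost all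
  of which meet \<open>range (f x)\<close>. Hence the \<open>i\<close>-th value of \<open>f x\<close> is eventually at most the maximum of
  the first \<open>2 i\<close> blocks.
\<close>

section \<open>The Lindelof property and countable large subcovers\<close>

lemma separable_metrizable_imp_Lindelof_space:
  assumes "separable_space X" "metrizable_space X"
  shows "Lindelof_space X"
proof -
  from assms(2) obtain M d where md: "Metric_space M d" and X: "X = Metric_space.mtopology M d"
    by (auto simp: metrizable_space_def)
  interpret Metric_space M d by (fact md)
  from assms(1) obtain C where C: "countable C" "C \<subseteq> M" "mtopology closure_of C = M"
    by (auto simp: separable_space_def X)
  show ?thesis unfolding Lindelof_space_alt X
  proof (intro allI impI)
    fix \<U> assume U: "(\<forall>U\<in>\<U>. openin mtopology U) \<and> topspace mtopology \<subseteq> \<Union>\<U>"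
    \<comment> \<open>Countably many balls around the dense set suffice: for each one inside some
      member of the cover, one such member is kept.\<close>
    define I where "I = {(c, n::nat). c \<in> C \<and> (\<exists>U\<in>\<U>. mball c (1 / Suc n) \<subseteq> U)}"
    have "countable I"
      by (rule countable_subset[of _ "C \<times> UNIV"]) (auto simp: I_def C)
    have "\<forall>p\<in>I. \<exists>U\<in>\<U>. mball (fst p) (1 / Suc (snd p)) \<subseteq> U"
      by (auto simp: I_def)
    then obtain u where u: "\<And>p. p \<in> I \<Longrightarrow> u p \<in> \<U> \<and> mball (fst p) (1 / Suc (snd p)) \<subseteq> u p"
      by metis
    have "topspace mtopology \<subseteq> \<Union>(u ` I)"
    proof
      fix x assume "x \<in> topspace mtopology"
      then have x: "x \<in> M" by simp
      with U obtain U where "U \<in> \<U>" "x \<in> U" "openin mtopology U" by auto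
      then obtain r where r: "r > 0" "mball x r \<subseteq> U"
        by (auto simp: openin_mtopology)
      obtain n where n: "1 / real (Suc n) < r / 2"
        using r nat_approx_posE[of "r/2"] by auto
      have "x \<in> mtopology closure_of C" using C x by simp
      then obtain c where c: "c \<in> C" "c \<in> mball x (1 / Suc n)"
        unfolding metric_closure_of
        by (simp only: mem_Collect_eq) (metis of_nat_0_less_iff zero_less_Suc zero_less_divide_1_iff)
      have "mball c (1 / Suc n) \<subseteq> mball x r"
      proof
        fix z assume "z \<in> mball c (1 / Suc n)"
        then show "z \<in> mball x r"
          using c n triangle[of x c z] by auto
      qed
      with r \<open>U \<in> \<U>\<close> c have "(c, n) \<in> I" by (auto simp: I_def)
      moreover have "x \<in> mball c (1 / Suc n)"
        using c by (simp add: commute)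
      ultimately show "x \<in> \<Union>(u ` I)"
        using u[of "(c,n)"] by auto
    qed
    then show "\<exists>\<V>. countable \<V> \<and> \<V> \<subseteq> \<U> \<and> topspace mtopology \<subseteq> \<Union>\<V>"
      using u \<open>countable I\<close> by (intro exI[of _ "u ` I"]) auto
  qed
qed

text \<open>The Lindelof property alone secures one member per point. Largeness makes the
  intersections of \<open>Suc n\<close> members cover \<open>X\<close> for each \<open>n\<close>;
  countable subcovers by these, taken for all \<open>n\<close>, leave no bound on the number of
  members at a point.\<close>

lemma countable_large_subcover:
  assumes "Lindelof_space X" "open_cover X \<U>" "large_cover X \<U>"
  obtains \<V> where "\<V> \<subseteq> \<U>" "countable \<V>" "open_cover X \<V>" "large_cover X \<V>"
proof -
  \<comment> \<open>The size \<open>Suc n\<close> excludes the empty family, whose intersection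
    \<open>UNIV\<close> need not be open.\<close>
  define I where "I n = {\<F>. \<F> \<subseteq> \<U> \<and> finite \<F> \<and> card \<F> = Suc n}" for n
  have "\<exists>\<G>. countable \<G> \<and> \<G> \<subseteq> I n \<and> topspace X \<subseteq> (\<Union>\<F>\<in>\<G>. \<Inter>\<F>)" for n
  proof -
    have "\<forall>V\<in>Inter ` I n. openin X V"
    proof
      fix V assume "V \<in> Inter ` I n"
      then obtain \<F> where "V = \<Inter>\<F>" "\<F> \<subseteq> \<U>" "finite \<F>" "\<F> \<noteq> {}"
        by (fastforce simp: I_def)
      then show "openin X V"
        using assms(2) by (auto simp: open_cover_def intro!: openin_Inter)
    qed
    moreover have "topspace X \<subseteq> \<Union>(Inter ` I n)"
    proof
      fix x assume "x \<in> topspace X"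
      then have "infinite {U\<in>\<U>. x \<in> U}"
        using assms(3) by (simp add: large_cover_def)
      then obtain \<F> where "finite \<F>" "card \<F> = Suc n" "\<F> \<subseteq> {U\<in>\<U>. x \<in> U}"
        using infinite_arbitrarily_large by blast
      then show "x \<in> \<Union>(Inter ` I n)"
        by (auto simp: I_def intro!: bexI[of _ \<F>])
    qed
    ultimately obtain \<V> where V: "countable \<V>" "\<V> \<subseteq> Inter ` I n" "topspace X \<subseteq> \<Union>\<V>"
      using assms(1) unfolding Lindelof_space_alt by meson
    then obtain \<G> where "countable \<G>" "\<G> \<subseteq> I n" "\<V> = Inter ` \<G>"
      using countable_subset_image[of \<V> Inter "I n"] by auto
    with V show ?thesis by blast
  qed
  then obtain \<G> where G: "\<And>n. countable (\<G> n)" "\<And>n. \<G> n \<subseteq> I n"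
    "\<And>n. topspace X \<subseteq> (\<Union>\<F>\<in>\<G> n. \<Inter>\<F>)" by metis
  define \<V> where "\<V> = (\<Union>n. \<Union>(\<G> n))"
  have sub: "\<V> \<subseteq> \<U>"
    using G(2) by (fastforce simp: \<V>_def I_def)
  have "countable \<V>"
  proof -
    have "countable (\<Union>\<F>\<in>\<G> n. \<F>)" for n
      using G(1,2) by (intro countable_UN) (auto simp: I_def intro: countable_finite)
    then show ?thesis unfolding \<V>_def by simp
  qed
  have large: "large_cover X \<V>"
    unfolding large_cover_def
  proof (intro ballI notI)
    fix x assume x: "x \<in> topspace X" and fin: "finite {U \<in> \<V>. x \<in> U}"
    define n where "n = card {U \<in> \<V>. x \<in> U}"
    obtain \<F> where F: "\<F> \<in> \<G> n" "x \<in> \<Inter>\<F>" using G(3)[of n] x by auto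
    then have "\<F> \<subseteq> {U \<in> \<V>. x \<in> U}" by (auto simp: \<V>_def)
    then have "card \<F> \<le> n" unfolding n_def using fin by (rule card_mono[rotated])
    then show False using F G(2)[of n] by (auto simp: I_def)
  qed
  have "open_cover X \<V>"
    unfolding open_cover_def
  proof
    show op: "\<forall>U\<in>\<V>. openin X U" using sub assms(2) by (auto simp: open_cover_def)
    have "x \<in> \<Union>\<V>" if "x \<in> topspace X" for x
    proof -
      have "{U\<in>\<V>. x \<in> U} \<noteq> {}"
        using large that infinite_imp_nonempty unfolding large_cover_def by blast
      then show ?thesis by blast
    qed
    moreover have "\<Union>\<V> \<subseteq> topspace X" using op openin_subset by (intro Union_least) blast
    ultimately show "\<Union>\<V> = topspace X" by blast
  qed
  with that sub \<open>countable \<V>\<close> large show ?thesis by blast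
qed

section \<open>From the Hurewicz property to groupability\<close>

lemma hurewicz_space_imp_groupable_cover:
  fixes X :: "'a topology"
  assumes H: "hurewicz_space X" and cnt: "countable \<U>"
    and cov: "open_cover X \<U>" and large: "large_cover X \<U>"
  shows "groupable_cover X \<U>"
\<comment> \<open>On the empty space singletons serve vacuously as groups; otherwise largeness makes
  \<open>\<U>\<close> infinite, so it has an injective enumeration.\<close>
proof (cases "topspace X = {}")
  case True
  then show ?thesis
    using partition_on_singletons[of \<U>]
    by (auto simp: groupable_cover_def large_cover_def)
next
  case False
  then have "infinite \<U>"
    using large by (auto simp: large_cover_def)
  define u where "u = from_nat_into \<U>"
  have bij: "bij_betw u UNIV \<U>"
    unfolding u_def by (rule bij_betw_from_nat_into[OF cnt \<open>infinite \<U>\<close>])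
  then have inj: "inj u" and ran: "range u = \<U>" by (auto simp: bij_betw_def)
  have tail: "\<exists>k\<ge>n. x \<in> u k" if "x \<in> topspace X" for x n
  proof (rule ccontr)
    assume "\<not> (\<exists>k\<ge>n. x \<in> u k)"
    then have "k < n" if "x \<in> u k" for k using that by (meson not_le)
    then have "{U\<in>\<U>. x \<in> U} \<subseteq> u ` {..<n}" unfolding ran[symmetric] by blast
    then have "finite {U\<in>\<U>. x \<in> U}" by (rule finite_subset) simp
    then show False using that large by (simp add: large_cover_def)
  qed
  have op: "openin X (u k)" for k
    using cov ran by (auto simp: open_cover_def)
  \<comment> \<open>These unions increase with \<open>m\<close>, so a finite subfamily lies within a
    single one, ending at some \<open>g\<close>.\<close>
  define \<C> where "\<C> n = range (\<lambda>m. \<Union>k\<in>{n..m}. u k)" for n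
  have "open_cover X (\<C> n)" for n
    unfolding open_cover_def \<C>_def
  proof
    show "\<Union>(range (\<lambda>m. \<Union>k\<in>{n..m}. u k)) = topspace X"
      using tail[of _ n] openin_subset[OF op] by fastforce
  qed (auto intro: op)
  with H obtain \<F> where F: "\<And>n. finite (\<F> n)" "\<And>n. \<F> n \<subseteq> \<C> n"
    and ev: "topspace X \<subseteq> (\<Union>n. \<Inter>m\<in>{n<..}. \<Union>(\<F> m))"
    unfolding hurewicz_space_def by metis
  have "\<exists>g. \<Union>(\<F> n) \<subseteq> (\<Union>k\<in>{n..g}. u k)" for n
  proof -
    obtain N where N: "finite N" "\<F> n = (\<lambda>m. \<Union>k\<in>{n..m}. u k) ` N"
      using finite_subset_image[OF F(1)[of n]] F(2)[of n] unfolding \<C>_def by metis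
    obtain g where "\<forall>m\<in>N. m \<le> g" using N(1) finite_nat_set_iff_bounded_le by auto
    with N(2) show ?thesis by (intro exI[of _ g]) fastforce
  qed
  then obtain g where g: "\<And>n. \<Union>(\<F> n) \<subseteq> (\<Union>k\<in>{n..g n}. u k)" by metis
  \<comment> \<open>Exceeding \<open>h k\<close> keeps the block nonempty; exceeding
    \<open>g (h k)\<close> makes the block starting at \<open>h k\<close> contain all of
    \<open>{h k..g (h k)}\<close>.\<close>
  define h where "h = rec_nat 0 (\<lambda>_ v. Suc (max v (g v)))"
  have h0: "h 0 = 0" and hS: "h (Suc k) = Suc (max (h k) (g (h k)))" for k
    by (auto simp: h_def)
  have sm: "strict_mono h" by (simp add: strict_mono_Suc_iff hS less_Suc_eq_le)
  define B where "B k = u ` {h k..<h (Suc k)}" for k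
  have "partition_on \<U> (range B)"
  proof (rule partition_onI)
    have "\<exists>k. m \<in> {h k..<h (Suc k)}" for m
    proof (induction m)
      case 0
      then show ?case using h0 hS by (intro exI[of _ 0]) auto
    next
      case (Suc m)
      then obtain k where k: "m \<in> {h k..<h (Suc k)}" by auto
      show ?case
      proof (cases "Suc m < h (Suc k)")
        case True
        with k show ?thesis by (intro exI[of _ k]) auto
      next
        case False
        with k have "Suc m = h (Suc k)" by auto
        then show ?thesis
          using sm by (intro exI[of _ "Suc k"]) (auto simp: strict_mono_def)
      qed
    qed
    then show "\<Union>(range B) = \<U>"
      unfolding ran[symmetric] B_def by blast
    have "B i \<inter> B j = {}" if "i < j" for i j
    proof -
      have "h (Suc i) \<le> h j" using that sm by (simp add: strict_mono_less_eq)
      then have "{h i..<h (Suc i)} \<inter> {h j..<h (Suc j)} = {}" by auto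
      then show ?thesis unfolding B_def image_Int[OF inj, symmetric] by simp
    qed
    then have "B i \<inter> B j = {}" if "i \<noteq> j" for i j
      using that by (metis Int_commute nat_neq_iff)
    then show "disjnt p q" if "p \<in> range B" "q \<in> range B" "p \<noteq> q" for p q
      using that unfolding disjnt_def by (elim rangeE) metis
    show "{} \<notin> range B" by (auto simp: B_def hS)
  qed
  moreover have "\<forall>\<F>\<in>range B. finite \<F>" by (auto simp: B_def)
  moreover have "finite {\<F>\<in>range B. x \<notin> \<Union>\<F>}" if x: "x \<in> topspace X" for x
  proof -
    from subsetD[OF ev x] obtain n where "x \<in> (\<Inter>m\<in>{n<..}. \<Union>(\<F> m))" by (rule UN_E)
    then have n: "x \<in> \<Union>(\<F> m)" if "n < m" for m
      using that by (simp only: INT_iff greaterThan_iff)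
    \<comment> \<open>The Hurewicz condition is used at index \<open>h k\<close>, which is at least
      \<open>k\<close> because \<open>h\<close> is strictly increasing.\<close>
    have "x \<in> \<Union>(B k)" if "n < k" for k
    proof -
      have "n < h k" using that strict_mono_imp_increasing[OF sm, of k] by linarith
      then have "x \<in> (\<Union>i\<in>{h k..g (h k)}. u i)" by (rule subsetD[OF g n])
      then show ?thesis by (auto simp: B_def hS)
    qed
    then have "k \<le> n" if "x \<notin> \<Union>(B k)" for k using that by (meson not_le)
    then have "{\<F>\<in>range B. x \<notin> \<Union>\<F>} \<subseteq> B ` {..n}" by blast
    then show ?thesis by (rule finite_subset) simp
  qed
  ultimately show ?thesis
    unfolding groupable_cover_def using large by blast
qed

section \<open>From groupability to the Hurewicz property\<close>

lemma clopen_index_refinement: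
  assumes "Lindelof_space X" "zero_dimensional_space X" "open_cover X \<U>" "topspace X \<noteq> {}"
  shows "\<exists>idx :: 'a \<Rightarrow> nat. (\<forall>k. openin X {x\<in>topspace X. idx x = k}) \<and>
    (\<forall>k. \<exists>U\<in>\<U>. {x\<in>topspace X. idx x = k} \<subseteq> U)"
proof -
  obtain \<B> where B: "\<And>V. V \<in> \<B> \<Longrightarrow> openin X V \<and> closedin X V"
    "\<And>U x. openin X U \<Longrightarrow> x \<in> U \<Longrightarrow> \<exists>V\<in>\<B>. x \<in> V \<and> V \<subseteq> U"
    using assms(2) unfolding zero_dimensional_space_def by metis
  define \<V> where "\<V> = {V\<in>\<B>. \<exists>U\<in>\<U>. V \<subseteq> U}"
  have "\<forall>V\<in>\<V>. openin X V" using B by (auto simp: \<V>_def)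
  moreover have "topspace X \<subseteq> \<Union>\<V>"
  proof
    fix x assume "x \<in> topspace X"
    then obtain U where "U \<in> \<U>" "openin X U" "x \<in> U"
      using assms(3) unfolding open_cover_def by blast
    then show "x \<in> \<Union>\<V>" using B(2)[of U x] by (auto simp: \<V>_def)
  qed
  ultimately obtain \<W> where W: "countable \<W>" "\<W> \<subseteq> \<V>" "topspace X \<subseteq> \<Union>\<W>"
    using assms(1) unfolding Lindelof_space_alt by meson
  then have "\<W> \<noteq> {}" using assms(4) by auto
  define w where "w = from_nat_into \<W>"
  have ran: "range w = \<W>" unfolding w_def using \<open>\<W> \<noteq> {}\<close> W(1) by simp
  then have wB: "w k \<in> \<V>" for k using W(2) by blast
  then have wc: "openin X (w k)" "closedin X (w k)" for k
    using B(1) by (auto simp: \<V>_def)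
  \<comment> \<open>The least index makes the clopen cover disjoint. Each piece removes only
    finitely many closed sets and so stays open; repetitions in \<open>w\<close> give empty
    pieces.\<close>
  define idx where "idx x = (LEAST k. x \<in> w k)" for x
  have ex: "\<exists>k. x \<in> w k" if "x \<in> topspace X" for x
    using W(3) ran that by blast
  have idx: "x \<in> w (idx x)" if "x \<in> topspace X" for x
    unfolding idx_def using LeastI_ex[OF ex[OF that]] .
  have level: "{x\<in>topspace X. idx x = k} = w k - (\<Union>j<k. w j)" for k
  proof (intro equalityI subsetI)
    fix x assume "x \<in> {x\<in>topspace X. idx x = k}"
    then have x: "x \<in> topspace X" "idx x = k" by auto
    then have "x \<notin> w j" if "j < k" for j
      using not_less_Least[of j "\<lambda>k. x \<in> w k"] that unfolding idx_def by blast
    then show "x \<in> w k - (\<Union>j<k. w j)" using idx[OF x(1)] x(2) by auto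
  next
    fix x assume x: "x \<in> w k - (\<Union>j<k. w j)"
    then have "idx x = k"
      unfolding idx_def by (intro Least_equality) (auto intro: leI)
    then show "x \<in> {x\<in>topspace X. idx x = k}"
      using x openin_subset[OF wc(1)] by blast
  qed
  show ?thesis
  proof (intro exI[of _ idx] conjI allI)
    show "openin X {x\<in>topspace X. idx x = k}" for k
      unfolding level by (intro openin_diff wc closedin_Union) (auto intro: wc)
    show "\<exists>U\<in>\<U>. {x\<in>topspace X. idx x = k} \<subseteq> U" for k
      unfolding level using wB[of k] by (auto simp: \<V>_def)
  qed
qed

text \<open>Open fibres mean continuity into a discrete space, which survives any binary operation;
  this is applied to sums of indices.\<close>

lemma openin_level_combine:
  assumes "\<And>k. openin X {x\<in>topspace X. f x = k}" "\<And>k. openin X {x\<in>topspace X. g x = k}"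
  shows "openin X {x\<in>topspace X. h (f x) (g x) = k}"
proof -
  have "{x\<in>topspace X. h (f x) (g x) = k} =
    (\<Union>(a,b)\<in>{(a,b). h a b = k}. {x\<in>topspace X. f x = a} \<inter> {x\<in>topspace X. g x = b})"
    by auto
  also have "openin X \<dots>"
    using assms by (intro openin_Union) auto
  finally show ?thesis .
qed

text \<open>Pigeonhole: if \<open>f i\<close> exceeded \<open>h (2 * i)\<close>, the disjoint blocks
  from \<open>c\<close> to \<open>2 * i\<close> would contain values of \<open>f\<close> at distinct
  arguments below \<open>i\<close>. There are at least \<open>i + 1\<close> such blocks; the factor
  2 makes up for the first \<open>c\<close>, which \<open>f\<close> may miss.\<close>

lemma strict_mono_bound_by_blocks:
  fixes f h :: "nat \<Rightarrow> nat"
  assumes sm: "strict_mono f" and disj: "disjoint_family A"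
    and meet: "\<And>i. c \<le> i \<Longrightarrow> A i \<inter> range f \<noteq> {}"
    and bound: "\<And>i j. j \<le> i \<Longrightarrow> A j \<subseteq> {..h i}"
    and "c \<le> i"
  shows "f i \<le> h (2 * i)"
proof (rule ccontr)
  assume neg: "\<not> f i \<le> h (2 * i)"
  have "\<forall>j\<in>{c..2*i}. \<exists>n. f n \<in> A j" using meet by fastforce
  then obtain n where n: "\<And>j. j \<in> {c..2*i} \<Longrightarrow> f (n j) \<in> A j" by metis
  have "inj_on n {c..2*i}"
  proof (rule inj_onI)
    fix j k assume "j \<in> {c..2*i}" "k \<in> {c..2*i}" "n j = n k"
    then show "j = k" using n[of j] n[of k] disj
      by (auto simp: disjoint_family_on_def)
  qed
  moreover have "n ` {c..2*i} \<subseteq> {..<i}"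
  proof
    fix m assume "m \<in> n ` {c..2*i}"
    then obtain j where j: "j \<in> {c..2*i}" "m = n j" by auto
    then have "f m \<le> h (2*i)" using n[OF j(1)] bound[of j "2*i"] by auto
    then have "f m < f i" using neg by simp
    then show "m \<in> {..<i}" using sm by (simp add: strict_mono_less)
  qed
  ultimately have "card {c..2*i} \<le> card {..<i}"
    by (metis card_image card_mono finite_lessThan)
  then show False using \<open>c \<le> i\<close> by simp
qed

text \<open>Finite groups cannot exhaust an infinite set in finitely many steps, and choosing an
  element of each group injects \<open>\<P>\<close> into the countable \<open>\<W>\<close>.\<close>

lemma partition_into_finite_enumeration:
  assumes "partition_on \<W> \<P>" "\<forall>\<F>\<in>\<P>. finite \<F>" "countable \<W>" "infinite \<W>"
  obtains B :: "nat \<Rightarrow> 'a set" where "bij_betw B UNIV \<P>"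
proof -
  have "infinite \<P>"
    using assms partition_onD1 by (metis finite_Union)
  moreover have "countable \<P>"
  proof (rule countable_image_inj_on)
    show "countable ((\<lambda>\<F>. SOME U. U \<in> \<F>) ` \<P>)"
    proof (rule countable_subset[OF _ assms(3)])
      show "(\<lambda>\<F>. SOME U. U \<in> \<F>) ` \<P> \<subseteq> \<W>"
        using assms(1) by (force simp: partition_on_def some_in_eq)
    qed
    show "inj_on (\<lambda>\<F>. SOME U. U \<in> \<F>) \<P>"
    proof (rule inj_onI)
      fix p q assume pq: "p \<in> \<P>" "q \<in> \<P>" "(SOME U. U \<in> p) = (SOME U. U \<in> q)"
      then have "(SOME U. U \<in> p) \<in> p" "(SOME U. U \<in> q) \<in> q"
        using assms(1) by (metis partition_onD3 some_in_eq)+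
      then show "p = q"
        using pq partition_onD2[OF assms(1)] by (metis disjoint_def disjoint_iff)
    qed
  qed
  ultimately show ?thesis using that bij_betw_from_nat_into by blast
qed

text \<open>A cover has no repetitions, so the sets \<open>{x. m \<in> range (f x)}\<close> must be pairwise distinct
  for them to form a large cover. This is what \<open>onto\<close> provides: if \<open>f x 0 = b > a\<close>, then \<open>x\<close>
  belongs to the \<open>b\<close>-th but not to the \<open>a\<close>-th set.\<close>

lemma eventually_bounded_if_groupable:
  fixes X :: "'a topology" and f :: "'a \<Rightarrow> nat \<Rightarrow> nat"
  assumes group: "\<And>\<U>. open_cover X \<U> \<Longrightarrow> large_cover X \<U> \<Longrightarrow>
      \<exists>\<W>\<subseteq>\<U>. groupable_cover X \<W>"
    and op: "\<And>n k. openin X {x\<in>topspace X. f x n = k}"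
    and sm: "\<And>x. strict_mono (f x)"
    and onto: "(\<lambda>x. f x 0) ` topspace X = UNIV"
  shows "\<exists>b. \<forall>x\<in>topspace X. \<exists>c. \<forall>i\<ge>c. f x i \<le> b i"
proof -
  define u where "u m = {x\<in>topspace X. m \<in> range (f x)}" for m
  have ne: "topspace X \<noteq> {}" using onto by auto
  have "u a \<noteq> u b" if "a < b" for a b
  proof -
    obtain x where x: "x \<in> topspace X" "f x 0 = b" using onto by (metis UNIV_I imageE)
    then have "f x n \<ge> b" for n using sm[of x] by (metis strict_mono_less_eq zero_le)
    then have "a \<notin> range (f x)" using that by (auto simp: not_le[symmetric])
    then have "x \<notin> u a" "x \<in> u b" using x by (auto simp: u_def)
    then show ?thesis by auto
  qed
  then have inj: "inj u" by (metis injI nat_neq_iff)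
  have large: "large_cover X (range u)"
    unfolding large_cover_def
  proof
    fix x assume x: "x \<in> topspace X"
    \<comment> \<open>Strict monotonicity gives infinitely many indices, and injectivity of
      \<open>u\<close> turns them into infinitely many distinct members.\<close>
    have "infinite (u ` range (f x))"
      using inj sm strict_mono_imp_inj_on
      by (metis finite_imageD inj_on_subset infinite_UNIV_nat top_greatest)
    moreover have "u ` range (f x) \<subseteq> {U\<in>range u. x \<in> U}" using x by (auto simp: u_def)
    ultimately show "infinite {U\<in>range u. x \<in> U}" using finite_subset by blast
  qed
  have "open_cover X (range u)"
    unfolding open_cover_def
  proof
    have "u m = (\<Union>n. {x\<in>topspace X. f x n = m})" for m by (auto simp: u_def)
    then show "\<forall>U\<in>range u. openin X U" using op by auto
    show "\<Union>(range u) = topspace X" by (auto simp: u_def)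
  qed
  with group[OF _ large] obtain \<W> \<P> where W: "\<W> \<subseteq> range u" "large_cover X \<W>"
    "partition_on \<W> \<P>" "\<forall>\<F>\<in>\<P>. finite \<F>"
    "\<And>x. x\<in>topspace X \<Longrightarrow> finite {\<F>\<in>\<P>. x \<notin> \<Union>\<F>}"
    unfolding groupable_cover_def by blast
  have "infinite \<W>" using W(2) ne by (auto simp: large_cover_def)
  have "countable \<W>" using countable_subset[OF W(1)] by simp
  obtain B :: "nat \<Rightarrow> 'a set set" where B: "bij_betw B UNIV \<P>"
    by (rule partition_into_finite_enumeration[OF W(3,4) \<open>countable \<W>\<close> \<open>infinite \<W>\<close>])
  then have BP: "B i \<in> \<P>" for i by (auto simp: bij_betw_def)
  \<comment> \<open>Pulling back along the injective \<open>u\<close> turns groups of open sets into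
    finite disjoint sets of naturals.\<close>
  define A where "A i = u -` B i" for i
  have finA: "finite (A i)" for i
    using W(4) BP inj by (auto simp: A_def intro: finite_vimageI)
  have "disjoint_family A"
    unfolding disjoint_family_on_def
  proof (intro ballI impI)
    fix i j :: nat assume "i \<noteq> j"
    then have "B i \<noteq> B j" using B by (auto simp: bij_betw_def dest: injD)
    then have "B i \<inter> B j = {}"
      using W(3) BP by (auto simp: partition_on_def disjoint_def)
    then show "A i \<inter> A j = {}" by (auto simp: A_def)
  qed
  \<comment> \<open>The inserted 0 keeps the maximum defined even if the union is empty.\<close>
  define h where "h i = Max (insert 0 (\<Union>j\<le>i. A j))" for i
  have h: "A j \<subseteq> {..h i}" if "j \<le> i" for i j
    unfolding h_def using that finA by (auto intro!: Max_ge)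
  have "\<exists>c. \<forall>i\<ge>c. f x i \<le> h (2 * i)" if x: "x \<in> topspace X" for x
  proof -
    have "finite {i. x \<notin> \<Union>(B i)}"
    proof -
      have "B ` {i. x \<notin> \<Union>(B i)} \<subseteq> {\<F>\<in>\<P>. x \<notin> \<Union>\<F>}" using BP by auto
      then have "finite (B ` {i. x \<notin> \<Union>(B i)})" using W(5)[OF x] finite_subset by blast
      then show ?thesis
        using B by (meson bij_betw_def finite_imageD inj_on_subset top_greatest)
    qed
    \<comment> \<open>As \<open>B\<close> is injective, the finitely many groups missing
      \<open>x\<close> have finitely many indices.\<close>
    then obtain c where c: "\<And>i. x \<notin> \<Union>(B i) \<Longrightarrow> i < c"
      using finite_nat_set_iff_bounded by auto
    have meet: "A i \<inter> range (f x) \<noteq> {}" if "c \<le> i" for i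
    proof -
      have "x \<in> \<Union>(B i)" using that c[of i] by linarith
      then obtain U where U: "U \<in> B i" "x \<in> U" by auto
      moreover have "U \<in> range u"
        using U(1) BP W(1) partition_onD1[OF W(3)] by blast
      ultimately show ?thesis by (auto simp: A_def u_def)
    qed
    have "f x i \<le> h (2 * i)" if "c \<le> i" for i
      by (rule strict_mono_bound_by_blocks[OF sm \<open>disjoint_family A\<close> meet h that])
    then show ?thesis by blast
  qed
  then show ?thesis by (intro exI[of _ "\<lambda>i. h (2 * i)"]) blast
qed

lemma groupable_imp_hurewicz_space:
  fixes X :: "'a topology"
  assumes lin: "Lindelof_space X" and zd: "zero_dimensional_space X"
    and group: "\<And>\<U>. open_cover X \<U> \<Longrightarrow> large_cover X \<U> \<Longrightarrow>
      \<exists>\<W>\<subseteq>\<U>. groupable_cover X \<W>"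
  shows "hurewicz_space X"
  unfolding hurewicz_space_def
proof (intro allI impI)
  fix \<U> :: "nat \<Rightarrow> 'a set set"
  assume cov: "\<forall>n. open_cover X (\<U> n)"
  show "\<exists>\<F>. (\<forall>n. finite (\<F> n) \<and> \<F> n \<subseteq> \<U> n) \<and>
             topspace X \<subseteq> (\<Union>n. \<Inter>m\<in>{n<..}. \<Union>(\<F> m))"
  \<comment> \<open>Finite subcovers of all the covers settle the claim at once. Otherwise some
    \<open>\<U> n0\<close> has none, so \<open>idx n0\<close> takes infinitely many values; these
    supply the surjectivity needed below.\<close>
  proof (cases "\<forall>n. \<exists>\<F>. finite \<F> \<and> \<F> \<subseteq> \<U> n \<and> topspace X \<subseteq> \<Union>\<F>")
    case True
    then obtain \<F> where "\<And>n. finite (\<F> n) \<and> \<F> n \<subseteq> \<U> n \<and> topspace X \<subseteq> \<Union>(\<F> n)"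
      by metis
    then show ?thesis by (intro exI[of _ \<F>]) blast
  next
    case False
    then obtain n0 where n0: "\<And>\<F>. finite \<F> \<Longrightarrow> \<F> \<subseteq> \<U> n0 \<Longrightarrow> \<not> topspace X \<subseteq> \<Union>\<F>"
      by metis
    have ne: "topspace X \<noteq> {}" using n0[of "{}"] by auto
    have "\<forall>n. \<exists>idx :: 'a \<Rightarrow> nat. (\<forall>k. openin X {x\<in>topspace X. idx x = k}) \<and>
        (\<forall>k. \<exists>U\<in>\<U> n. {x\<in>topspace X. idx x = k} \<subseteq> U)"
      using clopen_index_refinement[OF lin zd cov[rule_format] ne] by blast
    from choice[OF this] obtain idx :: "nat \<Rightarrow> 'a \<Rightarrow> nat" where
      idx_open: "\<And>n k. openin X {x\<in>topspace X. idx n x = k}" and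
      idx_ref: "\<And>n k. \<exists>U\<in>\<U> n. {x\<in>topspace X. idx n x = k} \<subseteq> U" by blast
    define w where "w n k = (SOME U. U \<in> \<U> n \<and> {x\<in>topspace X. idx n x = k} \<subseteq> U)" for n k
    have "w n k \<in> \<U> n \<and> {x\<in>topspace X. idx n x = k} \<subseteq> w n k" for n k
      unfolding w_def by (rule someI_ex) (use idx_ref in blast)
    then have w: "\<And>n k. w n k \<in> \<U> n"
      "\<And>n k. {x\<in>topspace X. idx n x = k} \<subseteq> w n k" by blast+
    define R where "R = idx n0 ` topspace X"
    have "infinite R"
    proof
      assume "finite R"
      then show False
        using n0[of "w n0 ` R"] w by (fastforce simp: R_def)
    qed
    then obtain e :: "nat \<Rightarrow> nat" where e: "bij_betw e R UNIV"
      using to_nat_on_infinite[of R] by auto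
    \<comment> \<open>The initial term makes \<open>f x 0\<close> run through all naturals; the
      increments force strict growth and make \<open>f x (Suc n)\<close> dominate
      \<open>idx n x\<close>.\<close>
    define f where "f x n = e (idx n0 x) + (\<Sum>j<n. Suc (idx j x))" for x n
    have fS: "f x (Suc n) = f x n + Suc (idx n x)" for x n by (simp add: f_def)
    have sm: "strict_mono (f x)" for x by (simp add: strict_mono_Suc_iff fS)
    have op: "openin X {x\<in>topspace X. f x n = k}" for n k
    proof (induction n arbitrary: k)
      case 0
      then show ?case
        using openin_level_combine[OF idx_open[of n0] idx_open[of n0], of "\<lambda>a b. e a"]
        by (simp add: f_def)
    next
      case (Suc n)
      show ?case unfolding fS
        using openin_level_combine[OF Suc.IH idx_open[of n], of "\<lambda>a b. a + Suc b"] by simp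
    qed
    have onto: "(\<lambda>x. f x 0) ` topspace X = UNIV"
    proof -
      have "(\<lambda>x. f x 0) ` topspace X = e ` R" by (auto simp: f_def R_def)
      then show ?thesis using e by (simp add: bij_betw_def)
    qed
    from eventually_bounded_if_groupable[OF group op sm onto]
    obtain b where b: "\<forall>x\<in>topspace X. \<exists>c. \<forall>i\<ge>c. f x i \<le> b i" ..
    \<comment> \<open>The bound is taken at \<open>Suc n\<close> because \<open>idx n x\<close>
      first enters the sum \<open>f x\<close> there.\<close>
    define \<F> where "\<F> n = w n ` {..b (Suc n)}" for n
    have "topspace X \<subseteq> (\<Union>n. \<Inter>m\<in>{n<..}. \<Union>(\<F> m))"
    proof
      fix x assume x: "x \<in> topspace X"
      then obtain c where c: "\<And>i. i \<ge> c \<Longrightarrow> f x i \<le> b i" using b by blast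
      have "x \<in> \<Union>(\<F> m)" if "c < m" for m
      proof -
        have "idx m x \<le> b (Suc m)" using c[of "Suc m"] that fS[of x m] by simp
        moreover have "x \<in> w m (idx m x)" using w(2) x by blast
        ultimately show ?thesis by (auto simp: \<F>_def)
      qed
      then show "x \<in> (\<Union>n. \<Inter>m\<in>{n<..}. \<Union>(\<F> m))" by blast
    qed
    then show ?thesis using w(1) by (intro exI[of _ \<F>]) (auto simp: \<F>_def)
  qed
qed

theorem theorem4:
  fixes X :: "'a topology"
  assumes "separable_space X" and "zero_dimensional_space X" and "metrizable_space X"
  shows "(hurewicz_space X \<longleftrightarrow>
            (\<forall>\<U>. open_cover X \<U> \<and> large_cover X \<U> \<longrightarrow>
               (\<exists>\<W>. \<W> \<subseteq> \<U> \<and> groupable_cover X \<W>)))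
       \<and> ((\<forall>\<U>. open_cover X \<U> \<and> large_cover X \<U> \<longrightarrow>
               (\<exists>\<W>. \<W> \<subseteq> \<U> \<and> groupable_cover X \<W>)) \<longleftrightarrow>
            (\<forall>\<U>. countable \<U> \<and> open_cover X \<U> \<and> large_cover X \<U> \<longrightarrow>
               groupable_cover X \<U>))"
proof -
  have lin: "Lindelof_space X"
    using assms separable_metrizable_imp_Lindelof_space by blast
  \<comment> \<open>The equivalences follow from a cycle: Hurewicz gives the countable condition,
    this gives the condition on subfamilies, and that gives Hurewicz.\<close>
  have "hurewicz_space X \<longrightarrow> (\<forall>\<U>. countable \<U> \<and> open_cover X \<U> \<and> large_cover X \<U> \<longrightarrow>
      groupable_cover X \<U>)"
    using hurewicz_space_imp_groupable_cover by blast
  moreover have "(\<forall>\<U>. countable \<U> \<and> open_cover X \<U> \<and> large_cover X \<U> \<longrightarrow> groupable_cover X \<U>)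
    \<longrightarrow> (\<forall>\<U>. open_cover X \<U> \<and> large_cover X \<U> \<longrightarrow> (\<exists>\<W>. \<W> \<subseteq> \<U> \<and> groupable_cover X \<W>))"
    using countable_large_subcover[OF lin] by metis
  moreover have "(\<forall>\<U>. open_cover X \<U> \<and> large_cover X \<U> \<longrightarrow>
      (\<exists>\<W>. \<W> \<subseteq> \<U> \<and> groupable_cover X \<W>)) \<longrightarrow> hurewicz_space X"
    using groupable_imp_hurewicz_space[OF lin assms(2)] by blast
  ultimately show ?thesis by argo
qed

end
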